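(* The projections of both $\mathsf B_{\mathfrak O}$ and $\mathsf S_{\mathfrak O}$ onto the $ac$-plane are the square: $$\pi_{ac}(\mathsf B_{\mathfrak O})=\pi_{ac}(\mathsf S_{\mathfrak O})=[-1,1]^2.$$ Moreover, $F(a,c)=U(a,c)$ for every $(a,c)\in[-1,1]^2$. Equivalently, for every $(a,c)\in[-1,1]^2$, $F(a,c)$ is the largest coefficient $b\in\mathbb R$ for which $ax^2+bxy+cy^2\le1$ for all $(x,y)\in\mathfrak O$. For each $(a,c)\in[-1,1]^2$, the polynomial $(a,F(a,c),c)$ belongs to $\mathsf S_{\mathfrak O}$.
   Context: Let $\tau=\sqrt2-1$ and $\mathfrak O=\{(x,y)\in[0,1]^2: x+y\le\sqrt2\}$. A triple $(a,b,c)\in\mathbb R^3$ is identified with the quadratic form $P(x,y)=ax^2+bxy+cy^2$, and $\|(a,b,c)\|_{\mathfrak O}=\sup\{|P(x,y)|:(x,y)\in\mathfrak O\}$. Let $\mathsf B_{\mathfrak O}=\{(a,b,c)\in\mathbb R^3:\|(a,b,c)\|_{\mathfrak O}\le1\}$, $\mathsf S_{\mathfrak O}=\{(a,b,c)\in\mathbb R^3:\|(a,b,c)\|_{\mathfrak O}=1\}$, and $\pi_{ac}(a,b,c)=(a,c)$. Let $L_1=\{(x,1):0\le x\le\tau\}$, $L_2=\{(x,\sqrt2-x):\tau\le x\le1\}$, $L_3=\{(1,y):0\le y\le\tau\}$, and for $(a,c)\in[-1,1]^2$ put $$U(a,c)=\inf\left\{\frac{1-ax^2-cy^2}{xy}:(x,y)\in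 L_1\cup L_2\cup L_3,\ xy>0\right\}.$$ Define the regions $$\mathcal A=\{(a,c)\in[-1,1]^2:a\le0,\ 1+\tau^2a\le c\le1\},$$ $$\mathcal B=\{(a,c)\in[-1,1]^2:a\le c,\ \tau+\tau^2a\le c\le1+\tau^2a\},$$ $$\mathcal C=\{(a,c)\in[-1,1]^2:c\le\tau+\tau^2a,\ a\le\tau+\tau^2c\},$$ $$\mathcal D=\{(a,c)\in[-1,1]^2:c\le a,\ \tau+\tau^2c\le a\le1+\tau^2c\},$$ $$\mathcal E=\{(a,c)\in[-1,1]^2:c\le0,\ 1+\tau^2c\le a\le1\},$$ which cover $[-1,1]^2$, have pairwise disjoint interiors, and overlap only in boundary pieces. Define $F:[-1,1]^2\to\mathbb R$ by $$F(a,c)=\begin{cases}2\sqrt{-a(1-c)},&(a,c)\in\mathcal A,\\ \dfrac{1-c}{\tau}-\tau a,&(a,c)\in\mathcal B,\\ 1+\sqrt{(1-2a)(1-2c)},&(a,c)\in\mathcal C,\\ \dfrac{1-a}{\tau}-\tau c,&(a,c)\in\mathcal D,\\ 2\sqrt{-c(1-a)},&(a,c)\in\mathcal E;\end{cases}$$ the formulas agree on all overlaps, so $F$ is well defined. *)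

theory Defs
  imports "HOL-Analysis.Analysis"
begin

definition tau :: real where
  "tau = sqrt 2 - 1"

definition octagon :: "(real \<times> real) set" where
  "octagon = {(x, y). x \<in> {0..1} \<and> y \<in> {0..1} \<and> x + y \<le> sqrt 2}"

definition quad_form :: "real \<times> real \<times> real \<Rightarrow> real \<times> real \<Rightarrow> real" where
  "quad_form = (\<lambda>(a, b, c) (x, y). a * x\<^sup>2 + b * x * y + c * y\<^sup>2)"

(* The supremum is a genuine one: octagon is nonempty and compact. *)
definition oct_norm :: "real \<times> real \<times> real \<Rightarrow> real" where
  "oct_norm P = (SUP z\<in>octagon. \<bar>quad_form P z\<bar>)"

definition oct_ball :: "(real \<times> real \<times> real) set" where
  "oct_ball = {P. oct_norm P \<le> 1}"

definition oct_sphere :: "(real \<times> real \<times> real) set" where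
  "oct_sphere = {P. oct_norm P = 1}"

definition proj_ac :: "real \<times> real \<times> real \<Rightarrow> real \<times> real" where
  "proj_ac = (\<lambda>(a, b, c). (a, c))"

definition square :: "(real \<times> real) set" where
  "square = {-1..1} \<times> {-1..1}"

definition edge1 :: "(real \<times> real) set" where
  "edge1 = {(x, 1) | x. 0 \<le> x \<and> x \<le> tau}"

definition edge2 :: "(real \<times> real) set" where
  "edge2 = {(x, sqrt 2 - x) | x. tau \<le> x \<and> x \<le> 1}"

definition edge3 :: "(real \<times> real) set" where
  "edge3 = {(1, y) | y. 0 \<le> y \<and> y \<le> tau}"

(* Used for a, c \<le> 1 only, where the set is nonempty and bounded below. *)
definition U_oct :: "real \<Rightarrow> real \<Rightarrow> real" where
  "U_oct a c = Inf {(1 - a * x\<^sup>2 - c * y\<^sup>2) / (x * y) | x y.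
     (x, y) \<in> edge1 \<union> edge2 \<union> edge3 \<and> x * y > 0}"

definition region_A :: "(real \<times> real) set" where
  "region_A = {(a, c) \<in> square. a \<le> 0 \<and> 1 + tau\<^sup>2 * a \<le> c \<and> c \<le> 1}"

definition region_B :: "(real \<times> real) set" where
  "region_B = {(a, c) \<in> square. a \<le> c \<and> tau + tau\<^sup>2 * a \<le> c \<and> c \<le> 1 + tau\<^sup>2 * a}"

definition region_C :: "(real \<times> real) set" where
  "region_C = {(a, c) \<in> square. c \<le> tau + tau\<^sup>2 * a \<and> a \<le> tau + tau\<^sup>2 * c}"

definition region_D :: "(real \<times> real) set" where
  "region_D = {(a, c) \<in> square. c \<le> a \<and> tau + tau\<^sup>2 * c \<le> a \<and> a \<le> 1 + tau\<^sup>2 * c}"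

definition region_E :: "(real \<times> real) set" where
  "region_E = {(a, c) \<in> square. c \<le> 0 \<and> 1 + tau\<^sup>2 * c \<le> a \<and> a \<le> 1}"

(* The order of the cases is immaterial, see F_oct_region_A to F_oct_region_E below.
   The value outside the square is irrelevant. *)
definition F_oct :: "real \<Rightarrow> real \<Rightarrow> real" where
  "F_oct a c =
    (if (a, c) \<in> region_A then 2 * sqrt (- a * (1 - c))
     else if (a, c) \<in> region_B then (1 - c) / tau - tau * a
     else if (a, c) \<in> region_C then 1 + sqrt ((1 - 2 * a) * (1 - 2 * c))
     else if (a, c) \<in> region_D then (1 - a) / tau - tau * c
     else if (a, c) \<in> region_E then 2 * sqrt (- c * (1 - a))
     else undefined)"

lemma tau_sq: "tau\<^sup>2 = 1 - 2 * tau"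
  by (simp add: tau_def power2_eq_square algebra_simps)

lemma tau_pos: "0 < tau"
  by (simp add: tau_def)

lemma tau_less_half: "tau < 1 / 2"
proof -
  have "sqrt 2 < 3 / 2"
    by (rule real_less_lsqrt) (auto simp: power2_eq_square)
  then show ?thesis by (simp add: tau_def)
qed

lemma tau_inverse: "1 / tau = tau + 2"
proof -
  have "tau * (tau + 2) = 1"
    using tau_sq by (simp add: power2_eq_square algebra_simps)
  then show ?thesis
    using tau_pos by (simp add: field_simps)
qed

lemma tau_sq_bounds: "0 < tau\<^sup>2" "tau\<^sup>2 < tau" "tau\<^sup>2 < 1"
proof -
  show "0 < tau\<^sup>2" using tau_pos by simp
  show *: "tau\<^sup>2 < tau"
    using tau_pos tau_less_half by (simp add: power2_eq_square)
  show "tau\<^sup>2 < 1" using * tau_less_half by linarith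
qed

lemma tau_sq_mult_bounds:
  assumes "-1 \<le> x" "x \<le> 1"
  shows "- (tau\<^sup>2) \<le> tau\<^sup>2 * x" "tau\<^sup>2 * x \<le> tau\<^sup>2"
  using mult_left_mono[of "-1" x "tau\<^sup>2"] mult_left_mono[of x 1 "tau\<^sup>2"] assms by auto

lemma regions_cover: "region_A \<union> region_B \<union> region_C \<union> region_D \<union> region_E = square"
proof
  show "region_A \<union> region_B \<union> region_C \<union> region_D \<union> region_E \<subseteq> square"
    by (auto simp: region_A_def region_B_def region_C_def region_D_def region_E_def)
  have half: "(a \<le> 0 \<and> 1 + tau\<^sup>2 * a \<le> c) \<or>
      (tau + tau\<^sup>2 * a \<le> c \<and> c \<le> 1 + tau\<^sup>2 * a) \<or>
      (c \<le> tau + tau\<^sup>2 * a \<and> a \<le> tau + tau\<^sup>2 * c)"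
    if "a \<le> c" "c \<le> 1" for a c :: real
  proof -
    have "a \<le> 0" if "1 + tau\<^sup>2 * a < c"
    proof (rule ccontr)
      assume "\<not> a \<le> 0"
      then have "tau\<^sup>2 * a > 0"
        using tau_sq_bounds(1) by (intro mult_pos_pos) linarith+
      then show False using that \<open>c \<le> 1\<close> by linarith
    qed
    moreover have "a \<le> tau + tau\<^sup>2 * c" if "c < tau + tau\<^sup>2 * a"
    proof -
      have "tau\<^sup>2 * a \<le> tau\<^sup>2 * c"
        using \<open>a \<le> c\<close> tau_sq_bounds(1) by (intro mult_left_mono) linarith+
      then show ?thesis using that \<open>a \<le> c\<close> by linarith
    qed
    ultimately show ?thesis by linarith
  qed
  show "square \<subseteq> region_A \<union> region_B \<union> region_C \<union> region_D \<union> region_E"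
  proof
    fix z assume z: "z \<in> square"
    obtain a c where zc: "z = (a, c)" by force
    have sq: "(a, c) \<in> square" "-1 \<le> a" "a \<le> 1" "-1 \<le> c" "c \<le> 1"
      using z zc by (auto simp: square_def)
    show "z \<in> region_A \<union> region_B \<union> region_C \<union> region_D \<union> region_E"
    proof (cases "a \<le> c")
      case True
      with sq half[of a c] show ?thesis
        unfolding zc region_A_def region_B_def region_C_def by auto
    next
      case False
      with sq half[of c a] show ?thesis
        unfolding zc region_C_def region_D_def region_E_def by auto
    qed
  qed
qed

lemma F_oct_region_A:
  "(a, c) \<in> region_A \<Longrightarrow> F_oct a c = 2 * sqrt (- a * (1 - c))"
  by (simp add: F_oct_def)

lemma F_oct_region_B:
  assumes "(a, c) \<in> region_B"
  shows "F_oct a c = (1 - c) / tau - tau * a"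
proof (cases "(a, c) \<in> region_A")
  case True
  then have c: "c = 1 + tau\<^sup>2 * a" and a: "a \<le> 0"
    using assms by (auto simp: region_A_def region_B_def)
  have "- a * (1 - c) = (- tau * a)\<^sup>2"
    by (simp add: c power2_eq_square)
  moreover have "- tau * a \<ge> 0"
    using a tau_pos by (simp add: mult_nonneg_nonpos)
  ultimately have "sqrt (- a * (1 - c)) = - tau * a"
    by (metis real_sqrt_unique)
  moreover have "(1 - c) / tau = - tau * a"
    using tau_pos by (simp add: c power2_eq_square)
  ultimately show ?thesis
    using True by (simp add: F_oct_def)
next
  case False
  then show ?thesis using assms by (simp add: F_oct_def)
qed

lemma tau_edge_le_half:
  assumes "c = tau + tau\<^sup>2 * a" "a \<le> tau + tau\<^sup>2 * c"
  shows "a \<le> 1 / 2"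
proof -
  have "a * (1 - tau\<^sup>2 * tau\<^sup>2) \<le> tau * (1 + tau\<^sup>2)"
    using assms by (simp add: algebra_simps)
  moreover have "1 - tau\<^sup>2 * tau\<^sup>2 = 2 * tau * (1 + tau\<^sup>2)"
  proof -
    have "1 - tau\<^sup>2 * tau\<^sup>2 = (1 - tau\<^sup>2) * (1 + tau\<^sup>2)"
      by (simp add: algebra_simps)
    also have "1 - tau\<^sup>2 = 2 * tau"
      by (simp add: tau_sq)
    finally show ?thesis .
  qed
  ultimately have "a * (2 * tau * (1 + tau\<^sup>2)) \<le> tau * (1 + tau\<^sup>2)"
    by simp
  then have "(tau * (1 + tau\<^sup>2)) * (2 * a) \<le> (tau * (1 + tau\<^sup>2)) * 1"
    by (simp add: mult_ac)
  moreover have "tau * (1 + tau\<^sup>2) > 0"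
    using tau_pos tau_sq_bounds(1) by (intro mult_pos_pos) linarith+
  ultimately have "2 * a \<le> 1"
    by (simp only: mult_le_cancel_left_pos)
  then show ?thesis by simp
qed

lemma F_BC_agree:
  assumes "c = tau + tau\<^sup>2 * a" "a \<le> tau + tau\<^sup>2 * c"
  shows "1 + sqrt ((1 - 2 * a) * (1 - 2 * c)) = (1 - c) / tau - tau * a"
proof -
  have "1 - 2 * c = tau\<^sup>2 * (1 - 2 * a)"
    unfolding assms(1) by (simp add: tau_sq algebra_simps)
  then have "(1 - 2 * a) * (1 - 2 * c) = (tau * (1 - 2 * a))\<^sup>2"
    by (simp add: power2_eq_square)
  moreover have "tau * (1 - 2 * a) \<ge> 0"
    using tau_edge_le_half[OF assms] tau_pos by simp
  ultimately have "sqrt ((1 - 2 * a) * (1 - 2 * c)) = tau * (1 - 2 * a)"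
    by simp
  moreover have "(1 - c) / tau = 1 / tau - 1 - tau * a"
    using tau_pos by (simp add: assms(1) power2_eq_square field_simps)
  ultimately show ?thesis
    by (simp add: tau_inverse algebra_simps)
qed

lemma F_oct_region_C:
  assumes "(a, c) \<in> region_C"
  shows "F_oct a c = 1 + sqrt ((1 - 2 * a) * (1 - 2 * c))"
proof -
  have notA: "(a, c) \<notin> region_A"
    using assms tau_less_half by (auto simp: region_A_def region_C_def)
  show ?thesis
  proof (cases "(a, c) \<in> region_B")
    case True
    then have "c = tau + tau\<^sup>2 * a" "a \<le> tau + tau\<^sup>2 * c"
      using assms by (auto simp: region_B_def region_C_def)
    from F_BC_agree[OF this] F_oct_region_B[OF True] show ?thesis by simp
  next
    case False
    then show ?thesis using notA assms by (simp add: F_oct_def)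
  qed
qed

lemma F_oct_region_D:
  assumes "(a, c) \<in> region_D"
  shows "F_oct a c = (1 - a) / tau - tau * c"
proof -
  have sq: "-1 \<le> a" "a \<le> 1" "-1 \<le> c" "c \<le> 1"
    using assms by (auto simp: region_D_def square_def)
  have notA: "(a, c) \<notin> region_A"
    using assms tau_sq_mult_bounds[OF sq(1,2)] tau_sq_bounds
    by (auto simp: region_A_def region_D_def)
  show ?thesis
  proof (cases "(a, c) \<in> region_B")
    case True
    then have "a = c"
      using assms by (auto simp: region_B_def region_D_def)
    with F_oct_region_B[OF True] show ?thesis by simp
  next
    case notB: False
    show ?thesis
    proof (cases "(a, c) \<in> region_C")
      case True
      then have "a = tau + tau\<^sup>2 * c" "c \<le> tau + tau\<^sup>2 * a"
        using assms by (auto simp: region_C_def region_D_def)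
      from F_BC_agree[OF this] F_oct_region_C[OF True] show ?thesis
        by (simp add: mult.commute)
    next
      case False
      then show ?thesis using notA notB assms by (simp add: F_oct_def)
    qed
  qed
qed

lemma F_oct_region_E:
  assumes "(a, c) \<in> region_E"
  shows "F_oct a c = 2 * sqrt (- c * (1 - a))"
proof -
  have sq: "-1 \<le> a" "a \<le> 1" "-1 \<le> c" "c \<le> 1"
    using assms by (auto simp: region_E_def square_def)
  have notA: "(a, c) \<notin> region_A"
    using assms tau_sq_mult_bounds[OF sq(1,2)] tau_sq_bounds
    by (auto simp: region_A_def region_E_def)
  have notB: "(a, c) \<notin> region_B"
    using assms tau_sq_mult_bounds[OF sq(3,4)] tau_sq_bounds
    by (auto simp: region_B_def region_E_def)
  have notC: "(a, c) \<notin> region_C"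
    using assms tau_less_half by (auto simp: region_C_def region_E_def)
  show ?thesis
  proof (cases "(a, c) \<in> region_D")
    case True
    then have a: "a = 1 + tau\<^sup>2 * c" and c: "c \<le> 0"
      using assms by (auto simp: region_D_def region_E_def)
    have "- c * (1 - a) = (- tau * c)\<^sup>2"
      by (simp add: a power2_eq_square)
    moreover have "- tau * c \<ge> 0"
      using c tau_pos by (simp add: mult_nonneg_nonpos)
    ultimately have "sqrt (- c * (1 - a)) = - tau * c"
      by (metis real_sqrt_unique)
    moreover have "(1 - a) / tau = - tau * c"
      using tau_pos by (simp add: a power2_eq_square)
    ultimately show ?thesis
      using F_oct_region_D[OF True] by simp
  next
    case False
    then show ?thesis using notA notB notC assms by (simp add: F_oct_def)
  qed
qed

end

theory Submission
  imports Defs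
begin

text \<open>
  On the octagon both \<open>y\<^sup>2 \<le> 1\<close> and \<open>(x + y)\<^sup>2 / 2 \<le> 1\<close>. In region A the form with middle coefficient \<open>F\<close>
  is \<open>y\<^sup>2\<close> minus a perfect square, in region C it is \<open>(x + y)\<^sup>2 / 2\<close> minus half a perfect square, and
  in region B it is at most \<open>y\<^sup>2\<close> for \<open>x \<le> \<tau>y\<close> and at most \<open>(x + y)\<^sup>2 / 2\<close> for \<open>\<tau>y \<le> x \<le> y\<close>, with
  equality on the ray through the vertex \<open>(\<tau>, 1)\<close>. In each case the value 1 is
  attained at a boundary point with \<open>xy > 0\<close>, except in region A when \<open>c = 1\<close>, where it may only be
  approached as \<open>x\<close> tends to 0.
  Regions D and E follow by exchanging the variables. The lower bound \<open>-1\<close> is easy, and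
  maximality of \<open>F\<close> forces the norm to be exactly 1: otherwise \<open>F\<close> could be increased.
\<close>

text \<open>Competitors b' are tested only at edge points with xy > 0, the points entering
  \<open>U_oct\<close>. As these lie in the octagon, this is stronger than maximality among
  coefficients admissible on the whole octagon, so one predicate serves both for
  \<open>U_oct\<close> and for the maximality claim.\<close>

definition is_max_mid :: "real \<Rightarrow> real \<Rightarrow> real \<Rightarrow> bool" where
  "is_max_mid a b c \<longleftrightarrow>
     (\<forall>z \<in> octagon. quad_form (a, b, c) z \<le> 1) \<and>
     (\<forall>b'. (\<forall>(x, y) \<in> edge1 \<union> edge2 \<union> edge3. x * y > 0 \<longrightarrow> quad_form (a, b', c) (x, y) \<le> 1)
        \<longrightarrow> b' \<le> b)"

section \<open>The octagon, its edges and criteria for maximality\<close>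

lemma quad_form_Pair [simp]: "quad_form (a, b, c) (x, y) = a * x\<^sup>2 + b * x * y + c * y\<^sup>2"
  by (simp add: quad_form_def)

lemma sqrt2_tau: "sqrt 2 = 1 + tau"
  by (simp add: tau_def)

lemma octagon_iff:
  "(x, y) \<in> octagon \<longleftrightarrow> 0 \<le> x \<and> x \<le> 1 \<and> 0 \<le> y \<and> y \<le> 1 \<and> x + y \<le> sqrt 2"
  by (auto simp: octagon_def)

lemma edges_subset_octagon: "edge1 \<union> edge2 \<union> edge3 \<subseteq> octagon"
  using tau_pos tau_less_half
  by (auto simp: edge1_def edge2_def edge3_def octagon_iff sqrt2_tau)

lemma octagon_sum_squared_le:
  assumes "(x, y) \<in> octagon"
  shows "(x + y)\<^sup>2 / 2 \<le> 1"
proof -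
  have "(x + y)\<^sup>2 \<le> (sqrt 2)\<^sup>2"
    using assms by (intro power_mono) (auto simp: octagon_iff)
  then show ?thesis by simp
qed

lemma edges_swap:
  "(y, x) \<in> edge1 \<union> edge2 \<union> edge3 \<longleftrightarrow> (x, y) \<in> edge1 \<union> edge2 \<union> edge3"
  by (auto simp: edge1_def edge2_def edge3_def sqrt2_tau)

lemma is_max_mid_swap:
  assumes "is_max_mid a b c"
  shows "is_max_mid c b a"
  unfolding is_max_mid_def
proof (intro conjI ballI allI impI)
  fix z assume "z \<in> octagon"
  then obtain x y where z: "z = (x, y)" and "(y, x) \<in> octagon"
    by (cases z) (auto simp: octagon_iff)
  then have "quad_form (a, b, c) (y, x) \<le> 1"
    using assms unfolding is_max_mid_def by blast
  then show "quad_form (c, b, a) z \<le> 1"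
    by (simp add: z algebra_simps)
next
  fix b'
  assume *: "\<forall>(x, y)\<in>edge1 \<union> edge2 \<union> edge3. 0 < x * y \<longrightarrow> quad_form (c, b', a) (x, y) \<le> 1"
  have "quad_form (a, b', c) (x, y) \<le> 1"
    if "(x, y) \<in> edge1 \<union> edge2 \<union> edge3" "x * y > 0" for x y
  proof -
    have "(y, x) \<in> edge1 \<union> edge2 \<union> edge3" "y * x > 0"
      using that edges_swap by (auto simp: mult.commute)
    then have "quad_form (c, b', a) (y, x) \<le> 1" using * by blast
    then show ?thesis by (simp add: algebra_simps)
  qed
  then show "b' \<le> b"
    using assms unfolding is_max_mid_def by blast
qed

text \<open>Where xy > 0 the form increases strictly with its middle coefficient, so a value 1
  attained there excludes every larger coefficient.\<close>

lemma is_max_midI_attained: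
  assumes "\<And>x y. (x, y) \<in> octagon \<Longrightarrow> a * x\<^sup>2 + b * x * y + c * y\<^sup>2 \<le> 1"
    and "(x0, y0) \<in> edge1 \<union> edge2 \<union> edge3" "x0 * y0 > 0"
    and "a * x0\<^sup>2 + b * x0 * y0 + c * y0\<^sup>2 = 1"
  shows "is_max_mid a b c"
  unfolding is_max_mid_def
proof (intro conjI ballI allI impI)
  fix z assume "z \<in> octagon"
  then show "quad_form (a, b, c) z \<le> 1"
    using assms(1) by (cases z) auto
next
  fix b'
  assume "\<forall>(x, y)\<in>edge1 \<union> edge2 \<union> edge3. 0 < x * y \<longrightarrow> quad_form (a, b', c) (x, y) \<le> 1"
  then have "quad_form (a, b', c) (x0, y0) \<le> 1" using assms(2,3) by blast
  then have "b' * (x0 * y0) \<le> b * (x0 * y0)"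
    using assms(4) by (simp add: mult.assoc)
  then show "b' \<le> b" using assms(3) by (rule mult_right_le_imp_le)
qed

section \<open>Maximality in regions A, B and C\<close>

lemma is_max_mid_c_eq_1:
  assumes "a \<le> 0"
  shows "is_max_mid a 0 1"
  unfolding is_max_mid_def
proof (intro conjI ballI allI impI)
  fix z assume "z \<in> octagon"
  then obtain x y where z: "z = (x, y)" and "0 \<le> y" "y \<le> 1"
    by (cases z) (auto simp: octagon_iff)
  then have "y\<^sup>2 \<le> 1" by (simp add: power_le_one)
  moreover have "a * x\<^sup>2 \<le> 0"
    using assms by (simp add: mult_nonpos_nonneg)
  ultimately show "quad_form (a, 0, 1) z \<le> 1" by (simp add: z)
next
  fix b
  assume *: "\<forall>(x, y)\<in>edge1 \<union> edge2 \<union> edge3. 0 < x * y \<longrightarrow> quad_form (a, b, 1) (x, y) \<le> 1"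
  show "b \<le> 0"
  proof (rule ccontr)
    assume "\<not> b \<le> 0"
    \<comment> \<open>The form at (x, 1) is 1 + x(ax + b). The bound \<open>tau\<close> keeps the
      point on \<open>edge1\<close>; the other gives x(1 - a) <= b/2, hence ax + b > 0. The
      denominator 1 - a stays positive even for a = 0.\<close>
    define x where "x = min tau (b / (1 - a) / 2)"
    have x: "0 < x" "x \<le> tau" "x \<le> b / (1 - a) / 2"
      using \<open>\<not> b \<le> 0\<close> assms tau_pos by (auto simp: x_def)
    then have "x * (1 - a) \<le> b / 2"
      using assms by (simp add: field_simps)
    then have "a * x + b > 0"
      using x \<open>\<not> b \<le> 0\<close> by (simp add: algebra_simps)
    then have "x * (a * x + b) > 0" using x by simp
    moreover have "(x, 1) \<in> edge1 \<union> edge2 \<union> edge3" "x * 1 > 0"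
      using x by (simp_all add: edge1_def)
    then have "quad_form (a, b, 1) (x, 1) \<le> 1" using * by blast
    ultimately show False by (simp add: power2_eq_square algebra_simps)
  qed
qed

lemma is_max_mid_A:
  assumes "(a, c) \<in> region_A"
  shows "is_max_mid a (F_oct a c) c"
proof (cases "c = 1")
  case True
  then show ?thesis
    using is_max_mid_c_eq_1[of a] assms F_oct_region_A[OF assms]
    by (auto simp: region_A_def)
next
  case False
  define u v where "u = sqrt (- a)" and "v = sqrt (1 - c)"
  have a: "a \<le> 0" and c: "c < 1" "1 + tau\<^sup>2 * a \<le> c"
    using assms False by (auto simp: region_A_def)
  have au: "a = - (u\<^sup>2)" and cv: "c = 1 - v\<^sup>2"
    using a c by (auto simp: u_def v_def)
  have F: "F_oct a c = 2 * u * v"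
    using F_oct_region_A[OF assms] by (simp add: u_def v_def real_sqrt_mult real_sqrt_minus)
  have v: "v > 0" using c by (simp add: v_def)
  \<comment> \<open>In terms of u and v, the lower bound on c says v <= \<open>tau\<close> u: the
    point (v/u, 1), where the square (ux - vy)^2 vanishes, lies on \<open>edge1\<close>.\<close>
  have "v\<^sup>2 \<le> (tau * u)\<^sup>2"
    using c(2) by (simp add: au cv power_mult_distrib)
  moreover have "tau * u \<ge> 0" using a tau_pos by (simp add: u_def)
  ultimately have vu: "v \<le> tau * u" by (rule power2_le_imp_le)
  then have "tau * u > 0" using v by linarith
  then have u: "u > 0" using tau_pos by (simp add: zero_less_mult_iff)
  show ?thesis
  proof (rule is_max_midI_attained)
    fix x y assume "(x, y) \<in> octagon"
    then have "y\<^sup>2 \<le> 1" by (auto simp: octagon_iff power_le_one)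
    moreover have "a * x\<^sup>2 + F_oct a c * x * y + c * y\<^sup>2 = y\<^sup>2 - (u * x - v * y)\<^sup>2"
      unfolding F by (simp add: au cv power2_eq_square algebra_simps)
    ultimately show "a * x\<^sup>2 + F_oct a c * x * y + c * y\<^sup>2 \<le> 1"
      by (smt (verit) zero_le_power2)
  next
    show "(v / u, 1) \<in> edge1 \<union> edge2 \<union> edge3"
      using u v vu by (simp add: edge1_def pos_divide_le_eq)
    show "v / u * 1 > 0" using u v by simp
    show "a * (v / u)\<^sup>2 + F_oct a c * (v / u) * 1 + c * 1\<^sup>2 = 1"
      unfolding F using u by (simp add: au cv power2_eq_square)
  qed
qed

lemma is_max_mid_B:
  assumes "(a, c) \<in> region_B"
  shows "is_max_mid a (F_oct a c) c"
proof (rule is_max_midI_attained)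
  define F where "F = F_oct a c"
  have ac: "a \<le> c" and lo: "tau + tau\<^sup>2 * a \<le> c" and hi: "c \<le> 1 + tau\<^sup>2 * a" and c1: "c \<le> 1"
    using assms by (auto simp: region_B_def square_def)
  have F: "F = (1 - c) * (tau + 2) - tau * a"
    using F_oct_region_B[OF assms] tau_inverse by (simp add: F_def divide_inverse)
  \<comment> \<open>Replacing \<open>tau\<close>^2 by 1 - 2 \<open>tau\<close>, also inside longer
    products, brings every polynomial in \<open>tau\<close> to degree at most 1.\<close>
  have tt: "tau * tau = 1 - 2 * tau" using tau_sq by (simp add: power2_eq_square)
  have ttx: "tau * (tau * x) = x - 2 * (tau * x)" for x
    using arg_cong[OF tt, of "\<lambda>t. t * x"] by (simp add: algebra_simps)
  note tau_simps = tt ttx power2_eq_square algebra_simps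
  \<comment> \<open>The second factor in the factorisation of \<open>q - (x + y)\<^sup>2 / 2\<close> by \<open>x - \<tau>y\<close>, where \<open>1 / \<tau> = \<tau> + 2\<close>.\<close>
  define \<alpha> \<beta> where "\<alpha> = a - 1 / 2" and "\<beta> = (1 / 2 - c) * (tau + 2)"
  \<comment> \<open>The linear form \<open>\<alpha> * x + \<beta> * y\<close> must be nonpositive on
    the cone \<open>tau\<close> y <= x <= y. Its values at the generators (\<open>tau\<close>, 1)
    and (1, 1) decide this; they are \<open>end1\<close> and \<open>end2\<close>.\<close>
  have end1: "\<alpha> * tau + \<beta> \<le> 0"
  proof -
    have "(c - tau - tau\<^sup>2 * a) * (tau + 2) \<ge> 0"
      using lo tau_pos by simp
    moreover have "\<alpha> * tau + \<beta> = - ((c - tau - tau\<^sup>2 * a) * (tau + 2))"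
      by (simp add: \<alpha>_def \<beta>_def tau_simps)
    ultimately show ?thesis by linarith
  qed
  have end2: "\<alpha> + \<beta> \<le> 0"
  proof -
    \<comment> \<open>A combination of the region inequalities \<open>ac\<close> and
      \<open>lo\<close>: the weight 1 + \<open>tau\<close> matches the constant terms, and the
      weight of c - a then matches the coefficients of a.\<close>
    have "2 * tau * (\<alpha> + \<beta>) =
        - ((2 * tau - tau * tau * (1 + tau)) * (c - a) + (1 + tau) * (c - tau - tau\<^sup>2 * a))"
      by (simp add: \<alpha>_def \<beta>_def tau_simps)
    also have "\<dots> \<le> 0"
      unfolding neg_le_0_iff_le
    proof (intro add_nonneg_nonneg mult_nonneg_nonneg)
      show "0 \<le> 2 * tau - tau * tau * (1 + tau)"
        using tau_less_half by (simp add: tau_simps)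
    qed (use ac lo tau_pos in simp_all)
    finally have "2 * tau * (\<alpha> + \<beta>) \<le> 0" .
    then show ?thesis using tau_pos by (simp add: mult_le_0_iff)
  qed
  have half: "a * x\<^sup>2 + F * x * y + c * y\<^sup>2 \<le> 1"
    if oct: "(x, y) \<in> octagon" and "x \<le> y" for x y
  proof (cases "x \<le> tau * y")
    case True
    have xy: "0 \<le> x" "0 \<le> y" "y \<le> 1" using oct by (auto simp: octagon_iff)
    \<comment> \<open>The cofactor of x - \<open>tau\<close> y in the form minus y^2, with
      \<open>tau\<close> + 2 in place of 1/\<open>tau\<close>.\<close>
    define G where "G = a * x + (1 - c) * (tau + 2) * y"
    have "tau\<^sup>2 * G = (tau * y - x) * (1 - c) + x * (1 + tau\<^sup>2 * a - c)"
      by (simp add: G_def tau_simps)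
    also have "\<dots> \<ge> 0"
      using xy True c1 hi by (intro add_nonneg_nonneg mult_nonneg_nonneg) simp_all
    finally have "G \<ge> 0" using tau_sq_bounds(1) by (simp add: zero_le_mult_iff)
    then have "(x - tau * y) * G \<le> 0"
      using True by (simp add: mult_nonpos_nonneg)
    moreover have "a * x\<^sup>2 + F * x * y + c * y\<^sup>2 = y\<^sup>2 + (x - tau * y) * G"
      by (simp add: G_def F tau_simps)
    moreover have "y\<^sup>2 \<le> 1" using xy by (simp add: power_le_one)
    ultimately show ?thesis by linarith
  next
    case False
    \<comment> \<open>(1 - \<open>tau\<close>)(x, y) expressed as a nonnegative combination of the
      generators (1, 1) and (\<open>tau\<close>, 1).\<close>
    have "(1 - tau) * (\<alpha> * x + \<beta> * y)
        = (x - tau * y) * (\<alpha> + \<beta>) + (y - x) * (\<alpha> * tau + \<beta>)"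
      by (simp add: algebra_simps)
    also have "\<dots> \<le> 0"
      using False \<open>x \<le> y\<close>
      by (intro add_nonpos_nonpos mult_nonneg_nonpos[OF _ end1] mult_nonneg_nonpos[OF _ end2]) simp_all
    finally have "\<alpha> * x + \<beta> * y \<le> 0"
      using tau_less_half by (simp add: mult_le_0_iff)
    then have "(x - tau * y) * (\<alpha> * x + \<beta> * y) \<le> 0"
      using False by (simp add: mult_nonneg_nonpos)
    moreover have "a * x\<^sup>2 + F * x * y + c * y\<^sup>2
        = (x + y)\<^sup>2 / 2 + (x - tau * y) * (\<alpha> * x + \<beta> * y)"
      by (simp add: \<alpha>_def \<beta>_def F tau_simps add_divide_distrib diff_divide_distrib)
    ultimately show ?thesis using octagon_sum_squared_le[OF oct] by linarith
  qed
  show "a * x\<^sup>2 + F_oct a c * x * y + c * y\<^sup>2 \<le> 1" if oct: "(x, y) \<in> octagon" for x y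
  proof (cases "x \<le> y")
    case True
    then show ?thesis using half oct by (simp add: F_def)
  next
    case False
    \<comment> \<open>Passing from (x, y) to (y, x) changes the value by (c - a)(x^2 - y^2) >= 0,
      which reduces to \<open>half\<close>.\<close>
    have "y\<^sup>2 \<le> x\<^sup>2" using False oct by (intro power_mono) (auto simp: octagon_iff)
    then have "(c - a) * (x\<^sup>2 - y\<^sup>2) \<ge> 0" using ac by simp
    moreover have "a * y\<^sup>2 + F * y * x + c * x\<^sup>2 \<le> 1"
      using False oct by (intro half) (auto simp: octagon_iff)
    ultimately show ?thesis by (simp add: F_def algebra_simps)
  qed
  show "(tau, 1) \<in> edge1 \<union> edge2 \<union> edge3" "tau * 1 > 0"
    using tau_pos by (simp_all add: edge1_def)
  have "a * tau\<^sup>2 + F * tau * 1 + c * 1\<^sup>2 = 1"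
    by (simp add: F tau_simps)
  then show "a * tau\<^sup>2 + F_oct a c * tau * 1 + c * 1\<^sup>2 = 1" by (simp add: F_def)
qed

text \<open>Substituting one inequality of the region into the other leaves a condition on a single
  coefficient. The bounds make the square roots used in region C genuine.\<close>

lemma region_C_le_half:
  assumes "(a, c) \<in> region_C"
  shows "a \<le> 1 / 2" "c \<le> 1 / 2"
proof -
  have *: "x \<le> 1 / 2" if "y \<le> tau + tau\<^sup>2 * x" "x \<le> tau + tau\<^sup>2 * y" for x y
  proof -
    have "tau\<^sup>2 * y \<le> tau\<^sup>2 * (tau + tau\<^sup>2 * x)"
      using that(1) tau_sq_bounds by (intro mult_left_mono) simp_all
    then show ?thesis using tau_edge_le_half[OF refl, of x] that(2) by linarith
  qed
  show "a \<le> 1 / 2" "c \<le> 1 / 2"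
    using *[of c a] *[of a c] assms by (auto simp: region_C_def)
qed

lemma is_max_mid_C:
  assumes "(a, c) \<in> region_C"
  shows "is_max_mid a (F_oct a c) c"
proof -
  define p r where "p = sqrt (1 - 2 * a)" and "r = sqrt (1 - 2 * c)"
  have nonneg: "p \<ge> 0" "r \<ge> 0"
    using region_C_le_half[OF assms] by (auto simp: p_def r_def)
  have p2: "p\<^sup>2 = 1 - 2 * a" and r2: "r\<^sup>2 = 1 - 2 * c"
    using region_C_le_half[OF assms] by (auto simp: p_def r_def)
  have F: "F_oct a c = 1 + p * r"
    using F_oct_region_C[OF assms] by (simp add: p_def r_def real_sqrt_mult)
  have q: "a * x\<^sup>2 + F_oct a c * x * y + c * y\<^sup>2 = (x + y)\<^sup>2 / 2 - (p * x - r * y)\<^sup>2 / 2" for x y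
  proof -
    have "(p * x - r * y)\<^sup>2 = p\<^sup>2 * x\<^sup>2 - 2 * (p * r) * (x * y) + r\<^sup>2 * y\<^sup>2"
      by (simp add: power2_eq_square algebra_simps)
    then show ?thesis
      unfolding F p2 r2 by (simp add: power2_eq_square field_simps)
  qed
  \<comment> \<open>Since 1 - 2 \<open>tau\<close> = \<open>tau\<close>^2, these are exactly the two
    inequalities of the region.\<close>
  have "(tau * p)\<^sup>2 \<le> r\<^sup>2" "(tau * r)\<^sup>2 \<le> p\<^sup>2"
    using assms by (auto simp: region_C_def p2 r2 power_mult_distrib tau_sq algebra_simps)
  then have pr: "tau * p \<le> r" "tau * r \<le> p"
    using nonneg by (auto intro: power2_le_imp_le)
  \<comment> \<open>The touching point on \<open>edge2\<close>, where px - ry vanishes: (r, p)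
    scaled to coordinate sum sqrt 2. The bounds \<open>pr\<close> are what keeps x between
    \<open>tau\<close> and 1. If p = r = 0, the form is 1 on all of \<open>edge2\<close> and any of
    its points serves.\<close>
  obtain x y where xy: "x + y = sqrt 2" "x * p = y * r" "tau \<le> x" "x \<le> 1"
  proof (cases "p + r = 0")
    case True
    then have "p = 0" "r = 0" using nonneg by auto
    then show ?thesis
      using that[of tau 1] tau_less_half by (simp add: sqrt2_tau)
  next
    case False
    then have pos: "p + r > 0" using nonneg by simp
    show ?thesis
    proof (rule that[of "r * sqrt 2 / (p + r)" "p * sqrt 2 / (p + r)"])
      show "r * sqrt 2 / (p + r) + p * sqrt 2 / (p + r) = sqrt 2"
        unfolding add_divide_distrib[symmetric] distrib_right[symmetric]
        using pos by (simp add: add.commute)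
      show "tau \<le> r * sqrt 2 / (p + r)" "r * sqrt 2 / (p + r) \<le> 1"
        using pos pr by (simp_all add: sqrt2_tau field_simps)
    qed simp
  qed
  show ?thesis
  proof (rule is_max_midI_attained)
    show "a * x\<^sup>2 + F_oct a c * x * y + c * y\<^sup>2 \<le> 1" if "(x, y) \<in> octagon" for x y
      using octagon_sum_squared_le[OF that] q[of x y] by (smt (verit) zero_le_power2 divide_nonneg_pos)
    have y: "y = sqrt 2 - x" using xy(1) by simp
    show "(x, y) \<in> edge1 \<union> edge2 \<union> edge3"
      using xy y by (auto simp: edge2_def)
    show "x * y > 0"
      using xy(3,4) tau_pos by (simp add: y sqrt2_tau)
    show "a * x\<^sup>2 + F_oct a c * x * y + c * y\<^sup>2 = 1"
      unfolding q using xy(1,2) by (simp add: mult.commute)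
  qed
qed

section \<open>The whole square, and the infimum \<open>U_oct\<close>\<close>

lemma region_swap:
  "(a, c) \<in> region_D \<Longrightarrow> (c, a) \<in> region_B"
  "(a, c) \<in> region_E \<Longrightarrow> (c, a) \<in> region_A"
  by (auto simp: region_A_def region_B_def region_D_def region_E_def square_def)

lemma square_cases:
  assumes "(a, c) \<in> square"
  obtains (A) "(a, c) \<in> region_A" | (B) "(a, c) \<in> region_B" | (C) "(a, c) \<in> region_C"
    | (D) "(a, c) \<in> region_D" | (E) "(a, c) \<in> region_E"
  using assms regions_cover by blast

lemma F_oct_swap:
  "(a, c) \<in> region_D \<Longrightarrow> F_oct a c = F_oct c a"
  "(a, c) \<in> region_E \<Longrightarrow> F_oct a c = F_oct c a"
  by (simp_all add: F_oct_region_D F_oct_region_E F_oct_region_A F_oct_region_B region_swap)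

lemma is_max_mid_F_oct:
  assumes "(a, c) \<in> square"
  shows "is_max_mid a (F_oct a c) c"
  using assms
proof (cases rule: square_cases)
  case D
  then show ?thesis
    using is_max_mid_swap[OF is_max_mid_B[OF region_swap(1)[OF D]]] F_oct_swap(1)[OF D] by simp
next
  case E
  then show ?thesis
    using is_max_mid_swap[OF is_max_mid_A[OF region_swap(2)[OF E]]] F_oct_swap(2)[OF E] by simp
qed (simp_all add: is_max_mid_A is_max_mid_B is_max_mid_C)

text \<open>Multiplying by xy > 0 turns a lower bound of the quotients into an admissible middle
  coefficient on the edges, so b is a lower bound and dominates all others.\<close>

lemma U_oct_eqI:
  assumes "is_max_mid a b c"
  shows "U_oct a c = b"
  unfolding U_oct_def
proof (rule cInf_eq)
  fix t
  assume "t \<in> {(1 - a * x\<^sup>2 - c * y\<^sup>2) / (x * y) | x y.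
     (x, y) \<in> edge1 \<union> edge2 \<union> edge3 \<and> x * y > 0}"
  then obtain x y where t: "t = (1 - a * x\<^sup>2 - c * y\<^sup>2) / (x * y)"
    and xy: "(x, y) \<in> edge1 \<union> edge2 \<union> edge3" "x * y > 0" by blast
  then have "quad_form (a, b, c) (x, y) \<le> 1"
    using assms edges_subset_octagon unfolding is_max_mid_def by blast
  then show "b \<le> t"
    using xy(2) by (simp add: t pos_le_divide_eq mult.assoc)
next
  fix b'
  assume *: "\<And>t. t \<in> {(1 - a * x\<^sup>2 - c * y\<^sup>2) / (x * y) | x y.
     (x, y) \<in> edge1 \<union> edge2 \<union> edge3 \<and> x * y > 0} \<Longrightarrow> b' \<le> t"
  have "quad_form (a, b', c) (x, y) \<le> 1"
    if "(x, y) \<in> edge1 \<union> edge2 \<union> edge3" "x * y > 0" for x y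
  proof -
    have "b' \<le> (1 - a * x\<^sup>2 - c * y\<^sup>2) / (x * y)"
      using that by (intro *) blast
    then show ?thesis
      using that(2) by (simp add: pos_le_divide_eq mult.assoc)
  qed
  then show "b' \<le> b"
    using assms unfolding is_max_mid_def by blast
qed

section \<open>The lower bound -1\<close>

lemma form_ge_minus_1_if_coeff_nonneg:
  assumes "a \<ge> 0 \<or> c \<ge> 0" "(a, c) \<in> square" "b \<ge> 0" "(x, y) \<in> octagon"
  shows "a * x\<^sup>2 + b * x * y + c * y\<^sup>2 \<ge> -1"
proof -
  have xy: "0 \<le> x\<^sup>2" "x\<^sup>2 \<le> 1" "0 \<le> y\<^sup>2" "y\<^sup>2 \<le> 1" "b * x * y \<ge> 0"
    using assms by (auto simp: octagon_iff power_le_one)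
  have "a * x\<^sup>2 \<ge> -1 * x\<^sup>2" "c * y\<^sup>2 \<ge> -1 * y\<^sup>2"
    using assms(2) xy by (intro mult_right_mono; simp add: square_def)+
  moreover have "a * x\<^sup>2 \<ge> 0 \<or> c * y\<^sup>2 \<ge> 0"
    using assms(1) by auto
  ultimately show ?thesis using xy by linarith
qed

lemma form_ge_minus_1_A:
  assumes "(a, c) \<in> region_A" "(x, y) \<in> octagon"
  shows "a * x\<^sup>2 + F_oct a c * x * y + c * y\<^sup>2 \<ge> -1"
proof (rule form_ge_minus_1_if_coeff_nonneg)
  have sq: "(a, c) \<in> square" "a \<le> 0" "1 + tau\<^sup>2 * a \<le> c" "c \<le> 1" "-1 \<le> a"
    using assms by (auto simp: region_A_def square_def)
  then show "(a, c) \<in> square" by simp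
  show "a \<ge> 0 \<or> c \<ge> 0"
    using tau_sq_mult_bounds[of a] tau_sq_bounds sq by linarith
  show "F_oct a c \<ge> 0"
    using sq F_oct_region_A[OF assms(1)] by (simp add: mult_nonpos_nonneg)
qed fact

lemma form_ge_minus_1_B:
  assumes "(a, c) \<in> region_B" "(x, y) \<in> octagon"
  shows "a * x\<^sup>2 + F_oct a c * x * y + c * y\<^sup>2 \<ge> -1"
proof -
  have sq: "(a, c) \<in> square" "-1 \<le> a" "a \<le> 1" "c \<le> 1" "a \<le> c"
    and lo: "tau + tau\<^sup>2 * a \<le> c"
    using assms(1) by (auto simp: region_B_def square_def)
  have F: "F_oct a c = (1 - c) / tau - tau * a" by (rule F_oct_region_B[OF assms(1)])
  have xy: "0 \<le> x" "0 \<le> y" using assms(2) by (auto simp: octagon_iff)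
  have q0: "(1 - c) / tau \<ge> 0" using sq tau_pos by simp
  show ?thesis
  proof (cases "a \<le> 0")
    case True
    then have "F_oct a c \<ge> 0"
      using F q0 tau_pos by (smt (verit) mult_nonneg_nonpos)
    moreover have "c \<ge> 0"
      using lo tau_sq_mult_bounds[OF sq(2,3)] tau_sq_bounds by linarith
    ultimately show ?thesis
      using sq(1) assms(2) by (intro form_ge_minus_1_if_coeff_nonneg) auto
  next
    case False
    \<comment> \<open>For a > 0 the middle coefficient may be negative, for example
      -\<open>tau\<close> at a = c = 1. Completing the square absorbs the cross term
      -\<open>tau\<close> axy.\<close>
    have "a * x\<^sup>2 + F_oct a c * x * y + c * y\<^sup>2
        = a * ((x - y)\<^sup>2 + (2 - tau) * (x * y)) + (1 - c) / tau * (x * y) + (c - a) * y\<^sup>2"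
      unfolding F by (simp add: power2_eq_square algebra_simps)
    also have "\<dots> \<ge> 0"
    proof -
      have "(2 - tau) * (x * y) \<ge> 0" using xy tau_less_half by simp
      then have "a * ((x - y)\<^sup>2 + (2 - tau) * (x * y)) \<ge> 0" using False by simp
      moreover have "(1 - c) / tau * (x * y) \<ge> 0"
        using q0 xy by (intro mult_nonneg_nonneg) assumption+
      moreover have "(c - a) * y\<^sup>2 \<ge> 0" using sq(5) by simp
      ultimately show ?thesis by linarith
    qed
    finally show ?thesis by linarith
  qed
qed

lemma form_ge_minus_1_C:
  assumes "(a, c) \<in> region_C" and oct: "(x, y) \<in> octagon"
  shows "a * x\<^sup>2 + F_oct a c * x * y + c * y\<^sup>2 \<ge> -1"
proof -
  have sq: "(a, c) \<in> square" "-1 \<le> a" "-1 \<le> c"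
    using assms(1) by (auto simp: region_C_def square_def)
  have F: "F_oct a c = 1 + sqrt ((1 - 2 * a) * (1 - 2 * c))"
    by (rule F_oct_region_C[OF assms(1)])
  have "sqrt ((1 - 2 * a) * (1 - 2 * c)) \<ge> 0"
    using region_C_le_half[OF assms(1)] by simp
  then have F0: "F_oct a c \<ge> 0" using F by simp
  show ?thesis
  proof (cases "a \<ge> 0 \<or> c \<ge> 0")
    case True
    then show ?thesis using form_ge_minus_1_if_coeff_nonneg sq(1) F0 oct by blast
  next
    case False
    have xy: "0 \<le> x" "x \<le> 1" "0 \<le> y" "y \<le> 1"
      using oct by (auto simp: octagon_iff)
    \<comment> \<open>With both outer coefficients negative, \<open>F_oct a c\<close> is at least 2,
      so the form equals -(x - y)^2 plus nonnegative terms.\<close>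
    have "1 * 1 \<le> (1 - 2 * a) * (1 - 2 * c)"
      using False by (intro mult_mono) auto
    then have "sqrt ((1 - 2 * a) * (1 - 2 * c)) \<ge> 1" by simp
    then have "(F_oct a c - 2) * (x * y) \<ge> 0" using F xy by simp
    moreover have "(a + 1) * x\<^sup>2 \<ge> 0" "(c + 1) * y\<^sup>2 \<ge> 0" using sq by simp_all
    moreover have "(x - y)\<^sup>2 \<le> 1"
      using xy by (simp add: abs_square_le_1 abs_le_iff)
    ultimately show ?thesis by (simp add: power2_eq_square algebra_simps)
  qed
qed

lemma form_ge_minus_1:
  assumes "(a, c) \<in> square" and oct: "(x, y) \<in> octagon"
  shows "a * x\<^sup>2 + F_oct a c * x * y + c * y\<^sup>2 \<ge> -1"
  using assms(1)
proof (cases rule: square_cases)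
  case D
  have "c * y\<^sup>2 + F_oct c a * y * x + a * x\<^sup>2 \<ge> -1"
    using oct by (intro form_ge_minus_1_B region_swap D) (auto simp: octagon_iff)
  then show ?thesis using F_oct_swap(1)[OF D] by (simp add: algebra_simps)
next
  case E
  have "c * y\<^sup>2 + F_oct c a * y * x + a * x\<^sup>2 \<ge> -1"
    using oct by (intro form_ge_minus_1_A region_swap E) (auto simp: octagon_iff)
  then show ?thesis using F_oct_swap(2)[OF E] by (simp add: algebra_simps)
qed (use oct form_ge_minus_1_A form_ge_minus_1_B form_ge_minus_1_C in auto)

section \<open>The norm and the projections\<close>

lemma bdd_above_quad_form: "bdd_above ((\<lambda>z. \<bar>quad_form P z\<bar>) ` octagon)"
proof -
  obtain a b c where P: "P = (a, b, c)" by (cases P)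
  have "\<bar>quad_form P (x, y)\<bar> \<le> \<bar>a\<bar> + \<bar>b\<bar> + \<bar>c\<bar>" if "(x, y) \<in> octagon" for x y
  proof -
    have xy: "0 \<le> x" "x \<le> 1" "0 \<le> y" "y \<le> 1"
      using that by (auto simp: octagon_iff)
    have "\<bar>a * x\<^sup>2\<bar> \<le> \<bar>a\<bar>" "\<bar>c * y\<^sup>2\<bar> \<le> \<bar>c\<bar>" "\<bar>b * (x * y)\<bar> \<le> \<bar>b\<bar>"
      using xy unfolding abs_mult
      by (auto intro!: mult_left_le simp: power_le_one abs_mult mult_le_one)
    then have "\<bar>a * x\<^sup>2 + b * (x * y) + c * y\<^sup>2\<bar> \<le> \<bar>a\<bar> + \<bar>b\<bar> + \<bar>c\<bar>"
      by linarith
    then show ?thesis unfolding P quad_form_Pair by (simp add: mult.assoc)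
  qed
  then show ?thesis by (intro bdd_aboveI[where M = "\<bar>a\<bar> + \<bar>b\<bar> + \<bar>c\<bar>"]) auto
qed

lemma abs_quad_form_le_oct_norm: "z \<in> octagon \<Longrightarrow> \<bar>quad_form P z\<bar> \<le> oct_norm P"
  unfolding oct_norm_def by (rule cSUP_upper[OF _ bdd_above_quad_form])

lemma proj_ac_oct_ball_subset: "proj_ac ` oct_ball \<subseteq> square"
proof
  fix w assume "w \<in> proj_ac ` oct_ball"
  then obtain a b c where w: "w = (a, c)" and "(a, b, c) \<in> oct_ball"
    by (auto simp: proj_ac_def)
  then have "\<bar>quad_form (a, b, c) z\<bar> \<le> 1" if "z \<in> octagon" for z
    using abs_quad_form_le_oct_norm[OF that, of "(a, b, c)"] by (simp add: oct_ball_def)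
  \<comment> \<open>At these two points the form takes the values a and c.\<close>
  from this[of "(1, 0)"] this[of "(0, 1)"] show "w \<in> square"
    by (simp add: w square_def octagon_iff abs_le_iff)
qed

lemma F_oct_in_oct_sphere:
  assumes "(a, c) \<in> square"
  shows "(a, F_oct a c, c) \<in> oct_sphere"
proof -
  define P where "P = (a, F_oct a c, c)"
  have max: "is_max_mid a (F_oct a c) c" by (rule is_max_mid_F_oct[OF assms])
  have "oct_norm P \<le> 1"
    unfolding oct_norm_def
  proof (rule cSUP_least)
    show "octagon \<noteq> {}" using octagon_iff[of 0 0] by auto
    show "\<bar>quad_form P z\<bar> \<le> 1" if z: "z \<in> octagon" for z
    proof -
      have "quad_form P z \<le> 1"
        using max z unfolding is_max_mid_def P_def by blast
      moreover have "quad_form P z \<ge> -1"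
        using form_ge_minus_1[OF assms] z by (cases z) (simp add: P_def)
      ultimately show ?thesis by simp
    qed
  qed
  moreover have "oct_norm P \<ge> 1"
  proof (rule ccontr)
    assume less: "\<not> oct_norm P \<ge> 1"
    \<comment> \<open>Raising the middle coefficient by the gap 1 - \<open>oct_norm P\<close> raises
      the form by at most that gap, since xy <= 1; so b would still be admissible on the
      edges.\<close>
    define b where "b = F_oct a c + (1 - oct_norm P)"
    have "quad_form (a, b, c) (x, y) \<le> 1"
      if "(x, y) \<in> edge1 \<union> edge2 \<union> edge3" for x y
    proof -
      have oct: "(x, y) \<in> octagon" using that edges_subset_octagon by blast
      then have "x * y \<le> 1" by (simp add: octagon_iff mult_le_one)
      then have "(1 - oct_norm P) * (x * y) \<le> 1 - oct_norm P"
        using less by (intro mult_left_le) auto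
      moreover have "quad_form P (x, y) \<le> oct_norm P"
        using abs_quad_form_le_oct_norm[OF oct, of P] by linarith
      moreover have "quad_form (a, b, c) (x, y)
          = quad_form P (x, y) + (1 - oct_norm P) * (x * y)"
        unfolding P_def quad_form_Pair by (simp add: b_def P_def algebra_simps)
      ultimately show ?thesis by linarith
    qed
    then have "b \<le> F_oct a c"
      using max unfolding is_max_mid_def by blast
    then show False using less by (simp add: b_def)
  qed
  ultimately show ?thesis by (simp add: oct_sphere_def P_def)
qed

theorem theorem3p1:
  "proj_ac ` oct_ball = square \<and>
   proj_ac ` oct_sphere = square \<and>
   (\<forall>(a, c) \<in> square. F_oct a c = U_oct a c) \<and>
   (\<forall>(a, c) \<in> square.
      (\<forall>z \<in> octagon. quad_form (a, F_oct a c, c) z \<le> 1) \<and>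
      (\<forall>b. (\<forall>z \<in> octagon. quad_form (a, b, c) z \<le> 1) \<longrightarrow> b \<le> F_oct a c)) \<and>
   (\<forall>(a, c) \<in> square. (a, F_oct a c, c) \<in> oct_sphere)"
proof -
  have "square \<subseteq> proj_ac ` oct_sphere"
    using F_oct_in_oct_sphere by (force simp: proj_ac_def image_iff)
  moreover have "proj_ac ` oct_sphere \<subseteq> proj_ac ` oct_ball"
    by (intro image_mono) (auto simp: oct_sphere_def oct_ball_def)
  ultimately have "proj_ac ` oct_ball = square" "proj_ac ` oct_sphere = square"
    using proj_ac_oct_ball_subset by order+
  moreover have "F_oct a c = U_oct a c" if "(a, c) \<in> square" for a c
    using U_oct_eqI[OF is_max_mid_F_oct[OF that]] by simp
  moreover have "\<forall>z \<in> octagon. quad_form (a, F_oct a c, c) z \<le> 1" if "(a, c) \<in> square" for a c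
    using is_max_mid_F_oct[OF that] unfolding is_max_mid_def by blast
  moreover have "b \<le> F_oct a c"
    if "(a, c) \<in> square" "\<forall>z \<in> octagon. quad_form (a, b, c) z \<le> 1" for a b c
  proof -
    have "\<forall>(x, y) \<in> edge1 \<union> edge2 \<union> edge3. x * y > 0 \<longrightarrow> quad_form (a, b, c) (x, y) \<le> 1"
      using that(2) edges_subset_octagon by blast
    then show ?thesis
      using is_max_mid_F_oct[OF that(1)] unfolding is_max_mid_def by blast
  qed
  ultimately show ?thesis
    using F_oct_in_oct_sphere by blast
qed

end
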